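(* Let $Z$ be a reflexive, separable Banach space, let $\mathcal{D}$ and $\mathcal{D}_h$ ($h\in\mathbb{N}$) be subsets of $Z$, and let $\mathcal{E}$ be a weakly sequentially closed subset of $Z$. Suppose: (i) (Mosco convergence) $\mathcal{D}=M\text{-}\lim_{h\to\infty}\mathcal{D}_h$ in $Z$. (ii) (Equi-transversality) There are constants $c>0$ and $b\ge0$ such that, for all $h$, all $y\in\mathcal{D}_h$ and all $z\in\mathcal{E}$, $$\|y-z\|\ge c(\|y\|+\|z\|)-b.$$ Then $$I_{\mathcal{E}}(\cdot)+d^2(\cdot,\mathcal{D})=\Gamma\text{-}\lim_{h\to\infty}\big(I_{\mathcal{E}}(\cdot)+d^2(\cdot,\mathcal{D}_h)\big)$$ with respect to the weak topology of $Z$. Moreover, if $(z_h)$ is a sequence of elements of $Z$ with $\sup_h \big(I_{\mathcal{E}}(z_h)+d^2(z_h,\mathcal{D}_h)\big)<\infty$, then there is a subsequence converging weakly to some $z\in\mathcal{E}$.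
   Context: $\overline{\mathbb{R}}=\mathbb{R}\cup\{\infty\}$. For a set $A$, $I_A(x)=0$ if $x\in A$ and $I_A(x)=\infty$ otherwise. $d(z,A)=\inf\{\|z-a\|:a\in A\}$. $\Gamma$-convergence: for a topological space $(X,\tau)$ and $F_h:X\to\overline{\mathbb{R}}$, the function $F:X\to\overline{\mathbb{R}}$ is the $\Gamma(\tau)$-limit of $F_h$ if for all $x\in X$ $$F(x)=\sup_{U\in\mathcal{N}(x)}\liminf_{h\to\infty}\inf_{y\in U}F_h(y)=\sup_{U\in\mathcal{N}(x)}\limsup_{h\to\infty}\inf_{y\in U}F_h(y),$$ where $\mathcal{N}(x)$ is the family of all open sets containing $x$. Mosco convergence of functions: for a Banach space $X$ and functions $F_h,F:X\to\overline{\mathbb{R}}$, $F=M\text{-}\lim_{h\to\infty}F_h$ if (1) for every sequence $x_h\rightharpoonup x$ weakly in $X$, $\liminf_h F_h(x_h)\ge F(x)$; and (2) for every $x\in X$ there is a sequence $x_h\to x$ strongly with $\lim_h F_h(x_h)=F(x)$. For sets, $\mathcal{D}=M\text{-}\lim\mathcal{D}_h$ means $I_{\mathcal{D}}=M\text{-}\lim I_{\mathcal{D}_h}$. *)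

theory Defs
  imports "HOL-Analysis.Analysis"
begin

lift_definition bidual_embed :: "'a::real_normed_vector \<Rightarrow> (('a \<Rightarrow>\<^sub>L real) \<Rightarrow>\<^sub>L real)"
  is "\<lambda>x f. blinfun_apply f x"
  by (rule blinfun.bounded_linear_left)

definition reflexive_space :: "'a::real_normed_vector itself \<Rightarrow> bool"
  where "reflexive_space _ \<longleftrightarrow>
    surj (bidual_embed :: 'a \<Rightarrow> (('a \<Rightarrow>\<^sub>L real) \<Rightarrow>\<^sub>L real))"

definition weak_topology :: "'a::real_normed_vector topology"
  where "weak_topology =
    topology_generated_by {blinfun_apply f -` U | (f :: 'a \<Rightarrow>\<^sub>L real) U. open U}"

lemma topspace_weak_topology [simp]:
  "topspace (weak_topology :: 'a::real_normed_vector topology) = UNIV"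
proof -
  have "(UNIV :: 'a set) = blinfun_apply (0 :: 'a \<Rightarrow>\<^sub>L real) -` UNIV"
    by simp
  then have "(UNIV :: 'a set) \<in> {blinfun_apply f -` U | (f :: 'a \<Rightarrow>\<^sub>L real) U. open U}"
    using open_UNIV by blast
  then show ?thesis
    unfolding weak_topology_def topology_generated_by_topspace by blast
qed

abbreviation weakly_tendsto :: "(nat \<Rightarrow> 'a::real_normed_vector) \<Rightarrow> 'a \<Rightarrow> bool"
  where "weakly_tendsto x l \<equiv> limitin weak_topology x l sequentially"

definition weakly_seq_closed :: "'a::real_normed_vector set \<Rightarrow> bool"
  where "weakly_seq_closed S \<longleftrightarrow>
    (\<forall>x l. (\<forall>n. x n \<in> S) \<and> weakly_tendsto x l \<longrightarrow> l \<in> S)"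

(* Functions with values in the reals together with infinity are taken ereal-valued;
   all functions to which the notions below are applied here are nonnegative. *)

definition ind_fun :: "'a set \<Rightarrow> 'a \<Rightarrow> ereal"
  where "ind_fun A x = (if x \<in> A then 0 else \<infinity>)"

(* Unlike infdist, this is infinity (the infimum of the empty set) when A is empty. *)
definition dist_set :: "'a::real_normed_vector \<Rightarrow> 'a set \<Rightarrow> ereal"
  where "dist_set z A = (INF a\<in>A. ereal (norm (z - a)))"

definition gamma_limit :: "'a topology \<Rightarrow> (nat \<Rightarrow> 'a \<Rightarrow> ereal) \<Rightarrow> ('a \<Rightarrow> ereal) \<Rightarrow> bool"
  where "gamma_limit T Fs F \<longleftrightarrow> (\<forall>x\<in>topspace T.
    F x = (SUP U\<in>{U. openin T U \<and> x \<in> U}. liminf (\<lambda>h. INF y\<in>U. Fs h y)) \<and>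
    F x = (SUP U\<in>{U. openin T U \<and> x \<in> U}. limsup (\<lambda>h. INF y\<in>U. Fs h y)))"

definition mosco_limit :: "(nat \<Rightarrow> 'a::banach \<Rightarrow> ereal) \<Rightarrow> ('a \<Rightarrow> ereal) \<Rightarrow> bool"
  where "mosco_limit Fs F \<longleftrightarrow>
    (\<forall>x l. weakly_tendsto x l \<longrightarrow> F l \<le> liminf (\<lambda>h. Fs h (x h))) \<and>
    (\<forall>l. \<exists>x. x \<longlonglongrightarrow> l \<and> (\<lambda>h. Fs h (x h)) \<longlonglongrightarrow> F l)"

definition mosco_limit_set :: "(nat \<Rightarrow> 'a::banach set) \<Rightarrow> 'a set \<Rightarrow> bool"
  where "mosco_limit_set Ds D \<longleftrightarrow> mosco_limit (\<lambda>h. ind_fun (Ds h)) (ind_fun D)"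

end

theory Submission
  imports Defs "HOL-Complex_Analysis.Great_Picard"
begin

text \<open>
  Two facts carry the proof: points with bounded penalised value stay bounded, and bounded
  sequences have weakly convergent subsequences.

  If \<open>z \<in> E\<close> has squared distance less than \<open>M\<close> from \<open>Dh h\<close>, choose \<open>a \<in> Dh h\<close> with
  \<open>norm (z - a) < sqrt M\<close>. Transversality bounds \<open>c * (norm a + norm z)\<close> by \<open>sqrt M + b\<close>, so both
  points lie in a ball independent of \<open>h\<close> (\<open>transversal_bound\<close>). By
  \<open>bounded_weakly_convergent_subsequence\<close>, applied twice, points and almost closest points converge
  weakly along a common subsequence, and the limit of the points is in \<open>E\<close> because \<open>E\<close> is
  weakly sequentially closed. This already gives the compactness assertion.

  For the upper bound of the Gamma-limit at \<open>x\<close> the constant sequence \<open>x\<close> suffices: each point of \<open>D\<close>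
  is a strong limit of points of \<open>Dh h\<close>, so the upper limit of the distances from \<open>x\<close> to \<open>Dh h\<close> is at most the
  distance to \<open>D\<close> (\<open>limsup_dist_sq_le\<close>).

  For the lower bound, suppose that the supremum over the weak neighbourhoods of \<open>x\<close> is below some
  real \<open>M\<close>. The weak topology need not be first countable, whereas the hypotheses on \<open>E\<close> and \<open>D\<close> concern
  sequences. Separability supplies countably many functionals that separate points. With the
  neighbourhoods defined by them one finds indices \<open>h k\<close> increasing to infinity and points \<open>y k\<close> with values
  below \<open>M\<close> on which each of these functionals tends to its value at \<open>x\<close>
  (\<open>gamma_liminf_sequence\<close>). Compactness gives a weak cluster point, which must be \<open>x\<close>; thus \<open>x \<in> E\<close>.
  The almost closest points converge weakly to some \<open>a\<close>, which is in \<open>D\<close> by Mosco convergence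
  (\<open>mosco_limit_set_weak_cluster\<close>), and \<open>norm (x - a) \<le> sqrt M\<close> by weak lower semicontinuity of
  the norm. So the limit functional at \<open>x\<close> is at most \<open>M\<close>.

  The functional analysis rests on the Hahn--Banach theorem, in the form that a sublinear
  function \<open>p\<close> dominates a linear one that agrees with it at a given point. Its proof
  applies Zorn's lemma to sublinear functions ordered pointwise, because the minimal ones are linear.
  Taking the norm for \<open>p\<close> yields norming functionals; taking the distance to a subspace yields
  density criteria, which in a reflexive separable space produce a countable set with dense span in
  the dual, as needed for the diagonal argument.
\<close>

section \<open>Linear functionals below a sublinear one\<close>
definition sublinear :: "('a::real_vector \<Rightarrow> real) \<Rightarrow> bool"
  where "sublinear p \<longleftrightarrow>
    (\<forall>x y. p (x + y) \<le> p x + p y) \<and> (\<forall>t x. 0 \<le> t \<longrightarrow> p (t *\<^sub>R x) = t * p x)"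

lemma sublinearI:
  assumes add: "\<And>x y. p (x + y) \<le> p x + p y" and zero: "p 0 = 0"
    and scale: "\<And>t x. 0 < t \<Longrightarrow> p (t *\<^sub>R x) \<le> t * p x"
  shows "sublinear p"
proof -
  have "p (t *\<^sub>R x) = t * p x" if "0 \<le> t" for t x
  proof (cases "t = 0")
    case True
    then show ?thesis by (simp add: zero)
  next
    case False
    with that have t: "0 < t" by simp
    have "p (inverse t *\<^sub>R (t *\<^sub>R x)) \<le> inverse t * p (t *\<^sub>R x)"
      using t by (intro scale) simp
    then have "t * p x \<le> p (t *\<^sub>R x)"
      using t by (simp add: field_simps)
    with scale[OF t, of x] show ?thesis by simp
  qed
  with add show ?thesis unfolding sublinear_def by blast
qed

lemma sublinear_add: "sublinear p \<Longrightarrow> p (x + y) \<le> p x + p y"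
  and sublinear_scale: "sublinear p \<Longrightarrow> 0 \<le> t \<Longrightarrow> p (t *\<^sub>R x) = t * p x"
  by (auto simp: sublinear_def)

lemma sublinear_zero: "sublinear p \<Longrightarrow> p 0 = 0"
  using sublinear_scale[of p 0 0] by simp

lemma sublinear_minus: "sublinear p \<Longrightarrow> - p (- x) \<le> p x"
  using sublinear_add[of p x "- x"] sublinear_zero[of p] by simp

text \<open>
  Subtracting \<open>t * p a\<close> while moving by \<open>t\<close> along \<open>a\<close> gives the largest sublinear function
  below \<open>p\<close> whose value at \<open>- a\<close> is at most \<open>- p a\<close>. A function that cannot be lowered in
  this way is additive in the direction \<open>a\<close>.
\<close>
definition tilt :: "('a::real_vector \<Rightarrow> real) \<Rightarrow> 'a \<Rightarrow> 'a \<Rightarrow> real"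
  where "tilt p a x = (INF t\<in>{0..}. p (x + t *\<^sub>R a) - t * p a)"

text \<open>
  The infimum is finite because sublinearity gives \<open>t * p a = p (t *\<^sub>R a) \<le> p (x + t *\<^sub>R a) + p (- x)\<close>,
  so that \<open>- p (- x)\<close> is a lower bound for all \<open>t\<close>.
\<close>
lemma tilt_le:
  assumes "sublinear p" "0 \<le> t"
  shows "tilt p a x \<le> p (x + t *\<^sub>R a) - t * p a"
  unfolding tilt_def
proof (rule cINF_lower)
  have "- p (- x) \<le> p (x + s *\<^sub>R a) - s * p a" if "0 \<le> s" for s
    using sublinear_add[OF assms(1), of "x + s *\<^sub>R a" "- x"]
      sublinear_scale[OF assms(1) that, of a] by simp
  then show "bdd_below ((\<lambda>t. p (x + t *\<^sub>R a) - t * p a) ` {0..})"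
    by (intro bdd_belowI2[where m = "- p (- x)"]) auto
qed (use assms in auto)

lemma tilt_greatest:
  assumes "\<And>t. 0 \<le> t \<Longrightarrow> m \<le> p (x + t *\<^sub>R a) - t * p a"
  shows "m \<le> tilt p a x"
  unfolding tilt_def using assms by (intro cINF_greatest) auto

lemma sublinear_tilt:
  assumes p: "sublinear p"
  shows "sublinear (tilt p a)"
proof (rule sublinearI)
  fix x y
  have key: "tilt p a (x + y) \<le> (p (x + s *\<^sub>R a) - s * p a) + (p (y + t *\<^sub>R a) - t * p a)"
    if "0 \<le> s" "0 \<le> t" for s t
    using tilt_le[OF p, of "s + t" a "x + y"] that
      sublinear_add[OF p, of "x + s *\<^sub>R a" "y + t *\<^sub>R a"]
    by (simp add: algebra_simps)
  have "tilt p a (x + y) - (p (x + s *\<^sub>R a) - s * p a) \<le> tilt p a y" if "0 \<le> s" for s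
    using key[OF that] by (intro tilt_greatest) (simp add: algebra_simps)
  then have "tilt p a (x + y) - tilt p a y \<le> tilt p a x"
    by (intro tilt_greatest) (simp add: algebra_simps)
  then show "tilt p a (x + y) \<le> tilt p a x + tilt p a y" by simp
next
  show "tilt p a 0 = 0"
    using tilt_le[OF p, of 0 a 0] tilt_greatest[of 0 p 0 a]
    by (simp add: sublinear_scale[OF p] sublinear_zero[OF p])
next
  fix s :: real and x
  assume s: "0 < s"
  have "inverse s * tilt p a (s *\<^sub>R x) \<le> tilt p a x"
  proof (rule tilt_greatest)
    fix t :: real
    assume t: "0 \<le> t"
    have "tilt p a (s *\<^sub>R x) \<le> p (s *\<^sub>R (x + t *\<^sub>R a)) - (s * t) * p a"
      using tilt_le[OF p, of "s * t" a "s *\<^sub>R x"] s t by (simp add: scaleR_add_right)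
    then have "tilt p a (s *\<^sub>R x) \<le> s * (p (x + t *\<^sub>R a) - t * p a)"
      using sublinear_scale[OF p, of s "x + t *\<^sub>R a"] s by (simp add: right_diff_distrib)
    then show "inverse s * tilt p a (s *\<^sub>R x) \<le> p (x + t *\<^sub>R a) - t * p a"
      using s by (simp add: field_simps)
  qed
  then show "tilt p a (s *\<^sub>R x) \<le> s * tilt p a x"
    using s by (simp add: field_simps)
qed

lemma tilt_below: "sublinear p \<Longrightarrow> tilt p a \<le> p"
  using tilt_le[of p 0 a] by (auto simp: le_fun_def)

text \<open>
  Minimality forces \<open>tilt q a = q\<close>, and the term \<open>t = 1\<close> of the infimum then reads
  \<open>q x \<le> q (x + a) - q a\<close>, which is the converse of subadditivity.
\<close>
lemma minimal_sublinear_linear: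
  assumes q: "sublinear q" and min: "\<And>r. sublinear r \<Longrightarrow> r \<le> q \<Longrightarrow> r = q"
  shows "linear q"
proof -
  have add: "q (x + a) = q x + q a" for x a
  proof -
    have "tilt q a = q"
      using min sublinear_tilt[OF q] tilt_below[OF q] by blast
    then have "q x \<le> q (x + a) - q a"
      using tilt_le[OF q, of 1 a x] by simp
    with sublinear_add[OF q, of x a] show ?thesis by simp
  qed
  have neg: "q (- x) = - q x" for x
    using add[of x "- x"] sublinear_zero[OF q] by simp
  have "q (t *\<^sub>R x) = t * q x" for t x
  proof (cases "0 \<le> t")
    case True
    then show ?thesis by (rule sublinear_scale[OF q])
  next
    case False
    then show ?thesis
      using sublinear_scale[OF q, of "- t" x] neg[of "t *\<^sub>R x"] by simp
  qed
  with add show ?thesis by (intro linearI) auto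
qed

text \<open>
  The pointwise infimum of a chain is finite, since every member lies above \<open>- p (- x)\<close> at \<open>x\<close>.
  It is subadditive because the values at \<open>x\<close> and at \<open>y\<close> can be estimated by the same,
  smaller one of two members.
\<close>
lemma sublinear_chain_lower_bound:
  assumes p: "sublinear p" and "C \<noteq> {}" and C: "\<And>q. q \<in> C \<Longrightarrow> sublinear q \<and> q \<le> p"
    and chain: "\<And>q r. q \<in> C \<Longrightarrow> r \<in> C \<Longrightarrow> q \<le> r \<or> r \<le> q"
  shows "\<exists>u. sublinear u \<and> (\<forall>q\<in>C. u \<le> q)"
proof -
  define u where "u x = (INF q\<in>C. q x)" for x
  have low: "u x \<le> q x" if "q \<in> C" for q x
    unfolding u_def
  proof (rule cINF_lower)
    have "- p (- x) \<le> r x" if "r \<in> C" for r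
      using C[OF that] sublinear_minus[of r x] le_funD[of r p "- x"] by linarith
    then show "bdd_below ((\<lambda>q. q x) ` C)"
      by (rule bdd_belowI2)
  qed fact
  have great: "m \<le> u x" if "\<And>q. q \<in> C \<Longrightarrow> m \<le> q x" for m x
    unfolding u_def using that \<open>C \<noteq> {}\<close> by (intro cINF_greatest) auto
  have "sublinear u"
  proof (rule sublinearI)
    fix x y
    have key: "u (x + y) \<le> q x + r y" if q: "q \<in> C" and r: "r \<in> C" for q r
      using chain[OF q r]
    proof
      assume "q \<le> r"
      then have "q x + q y \<le> q x + r y" by (simp add: le_fun_def)
      with low[OF q, of "x + y"] sublinear_add[of q x y] C[OF q] show ?thesis by linarith
    next
      assume "r \<le> q"
      then have "r x + r y \<le> q x + r y" by (simp add: le_fun_def)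
      with low[OF r, of "x + y"] sublinear_add[of r x y] C[OF r] show ?thesis by linarith
    qed
    have "u (x + y) - q x \<le> u y" if "q \<in> C" for q
      using key[OF that] by (intro great) (simp add: algebra_simps)
    then have "u (x + y) - u y \<le> u x"
      by (intro great) (simp add: algebra_simps)
    then show "u (x + y) \<le> u x + u y" by simp
  next
    obtain q where "q \<in> C" using \<open>C \<noteq> {}\<close> by blast
    then have "u 0 \<le> 0"
      using low[of q 0] C sublinear_zero by fastforce
    moreover have "0 \<le> u 0"
      using C sublinear_zero by (intro great) fastforce
    ultimately show "u 0 = 0" by simp
  next
    fix t :: real and x
    assume t: "0 < t"
    have "inverse t * u (t *\<^sub>R x) \<le> u x"
    proof (rule great)
      fix q assume "q \<in> C"
      with low[of q "t *\<^sub>R x"] C[of q] have "u (t *\<^sub>R x) \<le> t * q x"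
        using t sublinear_scale[of q t x] by simp
      then show "inverse t * u (t *\<^sub>R x) \<le> q x" using t by (simp add: field_simps)
    qed
    then show "u (t *\<^sub>R x) \<le> t * u x" using t by (simp add: field_simps)
  qed
  with low show ?thesis by (auto simp: le_fun_def)
qed

lemma linear_below_sublinear:
  assumes p: "sublinear p"
  shows "\<exists>f. linear f \<and> f \<le> p"
proof -
  define A where "A = {q. sublinear q \<and> q \<le> p}"
  have "p \<in> A" using p by (simp add: A_def)
  have "\<exists>m\<in>A. \<forall>a\<in>A. a \<le> m \<longrightarrow> a = m"
  proof (rule predicate_Zorn)
    show "partial_order_on A (relation_of (\<lambda>q r. r \<le> q) A)"
      by (rule partial_order_on_relation_ofI) auto
  next
    fix C assume "C \<in> Chains (relation_of (\<lambda>q r. r \<le> q) A)"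
    then have C: "q \<in> A" "q \<le> r \<or> r \<le> q" if "q \<in> C" "r \<in> C" for q r
      using that by (auto simp: Chains_def relation_of_def)
    show "\<exists>u\<in>A. \<forall>a\<in>C. u \<le> a"
    proof (cases "C = {}")
      case True
      then show ?thesis using \<open>p \<in> A\<close> by blast
    next
      case False
      then obtain q where "q \<in> C" by blast
      obtain u where "sublinear u" "\<forall>q\<in>C. u \<le> q"
        using sublinear_chain_lower_bound[OF p False] C by (auto simp: A_def)
      moreover have "u \<le> p"
        using calculation \<open>q \<in> C\<close> C(1)[of q q] by (auto simp: A_def intro: order_trans)
      ultimately show ?thesis by (auto simp: A_def)
    qed
  qed
  then obtain m where m: "sublinear m" "m \<le> p"
    and min: "\<And>a. sublinear a \<Longrightarrow> a \<le> p \<Longrightarrow> a \<le> m \<Longrightarrow> a = m"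
    by (auto simp: A_def)
  have "linear m"
    using m(1)
  proof (rule minimal_sublinear_linear)
    fix r assume "sublinear r" "r \<le> m"
    then show "r = m" using min m(2) order_trans by blast
  qed
  with m show ?thesis by blast
qed

text \<open>
  The form of the Hahn--Banach theorem that serves for both applications below. A linear function
  below \<open>tilt p a\<close> satisfies \<open>f (- a) \<le> - p a\<close>, that is, \<open>f a \<ge> p a\<close>; so there is no
  need to extend a functional from the line through \<open>a\<close>.
\<close>
lemma linear_below_sublinear_touching:
  assumes p: "sublinear p"
  shows "\<exists>f. linear f \<and> f \<le> p \<and> f a = p a"
proof -
  obtain f where f: "linear f" "f \<le> tilt p a"
    using linear_below_sublinear[OF sublinear_tilt[OF p]] by blast
  have "f (- a) \<le> - p a"
    using le_funD[OF f(2), of "- a"] tilt_le[OF p, of 1 a "- a"] sublinear_zero[OF p]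
    by simp
  then have "p a \<le> f a"
    by (simp add: linear_neg[OF f(1)])
  moreover have "f \<le> p"
    using f(2) tilt_below[OF p] by (rule order_trans)
  ultimately show ?thesis using f(1) by (auto simp: le_fun_def intro: antisym)
qed

lemma functional_below_seminorm:
  fixes p :: "'a::real_normed_vector \<Rightarrow> real"
  assumes p: "sublinear p" and bound: "\<And>x. p x \<le> norm x"
  shows "\<exists>f :: 'a \<Rightarrow>\<^sub>L real. norm f \<le> 1 \<and> (\<forall>x. blinfun_apply f x \<le> p x) \<and> blinfun_apply f a = p a"
proof -
  obtain f where f: "linear f" "f \<le> p" "f a = p a"
    using linear_below_sublinear_touching[OF p] by blast
  have le: "\<bar>f x\<bar> \<le> norm x" for x
    using bound[of x] bound[of "- x"] f(2) linear_neg[OF f(1), of x]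
    by (smt (verit) le_fun_def norm_minus_cancel)
  have bl: "bounded_linear f"
    using f(1) le by (intro bounded_linear.intro) (auto simp: bounded_linear_axioms_def intro!: exI[of _ 1])
  have "norm (Blinfun f) \<le> 1"
    using le by (intro norm_blinfun_bound) (auto simp: bounded_linear_Blinfun_apply[OF bl])
  then show ?thesis
    using f by (intro exI[of _ "Blinfun f"]) (auto simp: bounded_linear_Blinfun_apply[OF bl] le_fun_def)
qed

lemma norming_functional:
  fixes a :: "'a::real_normed_vector"
  shows "\<exists>f :: 'a \<Rightarrow>\<^sub>L real. norm f \<le> 1 \<and> blinfun_apply f a = norm a"
proof -
  have "sublinear (norm :: 'a \<Rightarrow> real)"
    by (rule sublinearI) (auto intro: norm_triangle_ineq)
  from functional_below_seminorm[OF this, of a] show ?thesis by auto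
qed

text \<open>
  The distance to a subspace is the quotient seminorm. A functional below it vanishes on the subspace,
  which is how the lemma after this one separates a point from a closed subspace.
\<close>
lemma sublinear_infdist_subspace:
  fixes S :: "'a::real_normed_vector set"
  assumes S: "subspace S"
  shows "sublinear (\<lambda>x. infdist x S)"
proof (rule sublinearI)
  have ne: "S \<noteq> {}" using subspace_0[OF S] by blast
  have great: "m \<le> infdist x S" if "\<And>s. s \<in> S \<Longrightarrow> m \<le> norm (x - s)" for m x
    unfolding infdist_notempty[OF ne] using that ne by (intro cINF_greatest) (auto simp: dist_norm)
  show "infdist 0 S = 0" using subspace_0[OF S] by simp
  fix x y
  have "infdist (x + y) S \<le> norm (x - s) + norm (y - t)" if "s \<in> S" "t \<in> S" for s t
  proof -
    have "infdist (x + y) S \<le> norm ((x + y) - (s + t))"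
      using infdist_le[OF subspace_add[OF S that], of "x + y"] by (simp add: dist_norm)
    also have "\<dots> \<le> norm (x - s) + norm (y - t)"
      using norm_triangle_ineq[of "x - s" "y - t"] by (simp add: algebra_simps)
    finally show ?thesis .
  qed
  then have "infdist (x + y) S - norm (x - s) \<le> infdist y S" if "s \<in> S" for s
    using that by (intro great) (simp add: algebra_simps)
  then have "infdist (x + y) S - infdist y S \<le> infdist x S"
    by (intro great) (simp add: algebra_simps)
  then show "infdist (x + y) S \<le> infdist x S + infdist y S" by simp
next
  have ne: "S \<noteq> {}" using subspace_0[OF S] by blast
  fix t :: real and x
  assume t: "0 < t"
  have "inverse t * infdist (t *\<^sub>R x) S \<le> infdist x S"
    unfolding infdist_notempty[OF ne, of x]
  proof (rule cINF_greatest[OF ne])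
    fix s assume "s \<in> S"
    then have "infdist (t *\<^sub>R x) S \<le> dist (t *\<^sub>R x) (t *\<^sub>R s)"
      by (intro infdist_le subspace_scale[OF S])
    also have "\<dots> = t * dist x s"
      using t by (simp add: dist_norm flip: scaleR_diff_right)
    finally show "inverse t * infdist (t *\<^sub>R x) S \<le> dist x s"
      using t by (simp add: field_simps)
  qed
  then show "infdist (t *\<^sub>R x) S \<le> t * infdist x S"
    using t by (simp add: field_simps)
qed

lemma dense_span_if_annihilator_trivial:
  fixes S :: "'a::real_normed_vector set"
  assumes ann: "\<And>g :: 'a \<Rightarrow>\<^sub>L real. (\<And>s. s \<in> S \<Longrightarrow> blinfun_apply g s = 0) \<Longrightarrow> g = 0"
  shows "closure (span S) = UNIV"
proof -
  have "x \<in> closure (span S)" for x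
  proof -
    have "infdist y (span S) \<le> norm y" for y
      using infdist_le[OF span_zero, of y S] by simp
    then obtain g :: "'a \<Rightarrow>\<^sub>L real"
      where g: "\<And>y. blinfun_apply g y \<le> infdist y (span S)" and gx: "blinfun_apply g x = infdist x (span S)"
      using functional_below_seminorm[OF sublinear_infdist_subspace[OF subspace_span]] by blast
    have "blinfun_apply g s = 0" if "s \<in> S" for s
      using g[of s] g[of "- s"] that by (simp add: span_base span_neg blinfun.minus_right)
    then have "g = 0" by (rule ann)
    with gx have "infdist x (span S) = 0" by simp
    then show ?thesis
      using in_closure_iff_infdist_zero[of "span S" x] span_zero by blast
  qed
  then show ?thesis by blast
qed

section \<open>Weak sequential compactness of bounded sets\<close>

text \<open>
  The sets that eventually contain the sequence whenever they contain \<open>l\<close> are closed under finite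
  intersections and arbitrary unions, so it suffices to look at the generating sets of the topology.
\<close>
lemma weakly_tendsto_iff:
  "weakly_tendsto x l \<longleftrightarrow>
    (\<forall>f :: 'a::real_normed_vector \<Rightarrow>\<^sub>L real. (\<lambda>n. blinfun_apply f (x n)) \<longlonglongrightarrow> blinfun_apply f l)"
proof
  assume weak: "weakly_tendsto x l"
  show "\<forall>f :: 'a \<Rightarrow>\<^sub>L real. (\<lambda>n. blinfun_apply f (x n)) \<longlonglongrightarrow> blinfun_apply f l"
  proof (intro allI topological_tendstoI)
    fix f :: "'a \<Rightarrow>\<^sub>L real" and U :: "real set"
    assume U: "open U" "blinfun_apply f l \<in> U"
    have "openin weak_topology (blinfun_apply f -` U)"
      unfolding weak_topology_def using U(1) by (intro topology_generated_by_Basis) blast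
    with weak U(2) show "\<forall>\<^sub>F n in sequentially. blinfun_apply f (x n) \<in> U"
      by (auto simp: limitin_def)
  qed
next
  assume lim: "\<forall>f :: 'a \<Rightarrow>\<^sub>L real. (\<lambda>n. blinfun_apply f (x n)) \<longlonglongrightarrow> blinfun_apply f l"
  have "l \<in> V \<longrightarrow> (\<forall>\<^sub>F n in sequentially. x n \<in> V)"
    if "generate_topology_on {blinfun_apply f -` U | (f :: 'a \<Rightarrow>\<^sub>L real) U. open U} V" for V
    using that
  proof induction
    case (Int a b)
    then show ?case by (auto intro: eventually_conj)
  next
    case (UN K)
    show ?case
    proof
      assume "l \<in> \<Union>K"
      then obtain k where "k \<in> K" "l \<in> k" by blast
      with UN.IH have "\<forall>\<^sub>F n in sequentially. x n \<in> k" by blast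
      then show "\<forall>\<^sub>F n in sequentially. x n \<in> \<Union>K"
        by (rule eventually_mono) (use \<open>k \<in> K\<close> in blast)
    qed
  next
    case (Basis s)
    then obtain f :: "'a \<Rightarrow>\<^sub>L real" and U where s: "s = blinfun_apply f -` U" "open U" by blast
    show ?case
    proof
      assume "l \<in> s"
      with s lim have "\<forall>\<^sub>F n in sequentially. blinfun_apply f (x n) \<in> U"
        using topological_tendstoD[of "\<lambda>n. blinfun_apply f (x n)"] by fastforce
      then show "\<forall>\<^sub>F n in sequentially. x n \<in> s" by (simp add: s)
    qed
  qed simp
  then show "weakly_tendsto x l"
    unfolding limitin_def topspace_weak_topology
    by (simp add: weak_topology_def openin_topology_generated_by_iff)
qed

lemma weakly_tendstoD:
  fixes f :: "'a::real_normed_vector \<Rightarrow>\<^sub>L real"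
  shows "weakly_tendsto x l \<Longrightarrow> (\<lambda>n. blinfun_apply f (x n)) \<longlonglongrightarrow> blinfun_apply f l"
  by (simp add: weakly_tendsto_iff)

text \<open>
  Weak lower semicontinuity of the norm: a functional of norm at most 1 that attains the norm of the
  limit carries the bound over.
\<close>
lemma norm_le_weak_limit:
  fixes x :: "nat \<Rightarrow> 'a::real_normed_vector"
  assumes weak: "weakly_tendsto x l" and le: "\<And>n. norm (x n) \<le> C"
  shows "norm l \<le> C"
proof -
  obtain f :: "'a \<Rightarrow>\<^sub>L real" where f: "norm f \<le> 1" "blinfun_apply f l = norm l"
    using norming_functional by blast
  have "blinfun_apply f (x n) \<le> C" for n
  proof -
    have "blinfun_apply f (x n) \<le> norm f * norm (x n)"
      using norm_blinfun[of f "x n"] by simp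
    also have "\<dots> \<le> 1 * norm (x n)"
      by (intro mult_right_mono f) simp
    finally show ?thesis using le[of n] by simp
  qed
  then show ?thesis
    using LIMSEQ_le_const2[OF weakly_tendstoD[OF weak, of f], of C] f(2) by auto
qed

text \<open>
  Functionals that norm the points of a countable dense set separate points: if all of them
  vanish at \<open>x\<close>, then the one belonging to a point \<open>a\<close> near \<open>x\<close> gives
  \<open>norm a \<le> norm (a - x)\<close>, so \<open>norm x\<close> is arbitrarily small.
\<close>
lemma separating_functionals:
  assumes "separable_space (euclidean :: 'a::real_normed_vector topology)"
  obtains \<phi> :: "nat \<Rightarrow> 'a::real_normed_vector \<Rightarrow>\<^sub>L real"
  where "\<And>n. norm (\<phi> n) \<le> 1" "\<And>x. (\<And>n. blinfun_apply (\<phi> n) x = 0) \<Longrightarrow> x = 0"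
proof -
  obtain C :: "'a set" where C: "countable C" "closure C = UNIV"
    using assms by (auto simp: separable_space_def)
  then have "C \<noteq> {}" by auto
  have "\<exists>f :: 'a \<Rightarrow>\<^sub>L real. norm f \<le> 1 \<and> blinfun_apply f (from_nat_into C n) = norm (from_nat_into C n)" for n
    by (rule norming_functional)
  then obtain \<phi> :: "nat \<Rightarrow> 'a \<Rightarrow>\<^sub>L real" where \<phi>: "\<And>n. norm (\<phi> n) \<le> 1"
    "\<And>n. blinfun_apply (\<phi> n) (from_nat_into C n) = norm (from_nat_into C n)"
    by metis
  have "x = 0" if zero: "\<And>n. blinfun_apply (\<phi> n) x = 0" for x
  proof (rule ccontr)
    assume "x \<noteq> 0"
    then have "norm x / 2 > 0" by simp
    then obtain a where a: "a \<in> C" "dist a x < norm x / 2"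
      using C(2) closure_approachable[of x C] by blast
    then obtain n where n: "a = from_nat_into C n"
      using from_nat_into_surj[OF C(1)] by metis
    have "norm a = blinfun_apply (\<phi> n) (a - x)"
      using zero[of n] \<phi>(2)[of n] by (simp add: n blinfun.diff_right)
    also have "\<dots> \<le> norm (\<phi> n) * norm (a - x)"
      using norm_blinfun[of "\<phi> n" "a - x"] by simp
    also have "\<dots> \<le> 1 * norm (a - x)"
      by (intro mult_right_mono \<phi>) simp
    finally have "norm x \<le> 2 * norm (a - x)"
      using norm_triangle_ineq2[of x a] by (simp add: norm_minus_commute)
    with a(2) show False by (simp add: dist_norm)
  qed
  with \<phi>(1) that show ?thesis by blast
qed

text \<open>
  On a bounded sequence, nearby functionals take uniformly close values, so the Cauchy property
  passes to limits of functionals.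
\<close>
lemma convergent_on_closure_span:
  fixes x :: "nat \<Rightarrow> 'a::real_normed_vector" and f :: "'a \<Rightarrow>\<^sub>L real"
  assumes bound: "\<And>n. norm (x n) \<le> R"
    and conv: "\<And>g. g \<in> S \<Longrightarrow> convergent (\<lambda>n. blinfun_apply g (x n))"
    and f: "f \<in> closure (span S)"
  shows "convergent (\<lambda>n. blinfun_apply f (x n))"
proof -
  have span: "convergent (\<lambda>n. blinfun_apply g (x n))" if "g \<in> span S" for g
    using that
  proof (induction rule: span_induct_alt)
    case base
    then show ?case by (simp add: convergent_const)
  next
    case (step c g h)
    then show ?case
      using conv[of g]
      by (auto simp: blinfun.add_left blinfun.scaleR_left
          intro!: convergent_add convergent_mult convergent_const)
  qed
  have R: "0 \<le> R" using norm_ge_zero bound order_trans by blast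
  have "Cauchy (\<lambda>n. blinfun_apply f (x n))"
  proof (rule metric_CauchyI)
    fix e :: real assume e: "0 < e"
    \<comment> \<open>The summand 1 keeps the denominator positive when the sequence is zero and \<open>R = 0\<close>.\<close>
    define \<delta> where "\<delta> = e / (3 * (R + 1))"
    have \<delta>: "0 < \<delta>" using e R by (simp add: \<delta>_def)
    obtain g where g: "g \<in> span S" "norm (g - f) < \<delta>"
      using f \<delta> closure_approachable[of f "span S"] by (auto simp: dist_norm)
    have close: "dist (blinfun_apply g (x n)) (blinfun_apply f (x n)) < e / 3" for n
    proof -
      have "dist (blinfun_apply g (x n)) (blinfun_apply f (x n)) \<le> norm (g - f) * norm (x n)"
        using norm_blinfun[of "g - f" "x n"] by (simp add: dist_norm blinfun.diff_left)
      also have "\<dots> \<le> \<delta> * R"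
        using g(2) bound[of n] R \<delta> by (intro mult_mono) auto
      also have "\<dots> < \<delta> * (R + 1)" using \<delta> by simp
      also have "\<dots> = e / 3" using R by (simp add: \<delta>_def divide_simps)
      finally show ?thesis .
    qed
    obtain N where N: "\<And>m n. m \<ge> N \<Longrightarrow> n \<ge> N \<Longrightarrow>
        dist (blinfun_apply g (x m)) (blinfun_apply g (x n)) < e / 3"
      using metric_CauchyD[OF convergent_Cauchy[OF span[OF g(1)]], of "e / 3"] e by auto
    have "dist (blinfun_apply f (x m)) (blinfun_apply f (x n)) < e" if "m \<ge> N" "n \<ge> N" for m n
      using dist_triangle_third[OF _ N[OF that] close[of n]] close[of m] by (simp add: dist_commute)
    then show "\<exists>N. \<forall>m\<ge>N. \<forall>n\<ge>N. dist (blinfun_apply f (x m)) (blinfun_apply f (x n)) < e"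
      by blast
  qed
  then show ?thesis by (simp add: Cauchy_convergent_iff)
qed

text \<open>
  The pointwise limit of the evaluations at \<open>x n\<close> is a bounded functional on the dual space, and
  reflexivity says that it is the evaluation at some point.
\<close>
lemma weak_limit_if_functionals_converge:
  fixes x :: "nat \<Rightarrow> 'a::real_normed_vector"
  assumes reflexive: "reflexive_space TYPE('a)" and bound: "\<And>n. norm (x n) \<le> R"
    and conv: "\<And>f :: 'a \<Rightarrow>\<^sub>L real. convergent (\<lambda>n. blinfun_apply f (x n))"
  obtains l where "weakly_tendsto x l"
proof -
  define L where "L f = lim (\<lambda>n. blinfun_apply f (x n))" for f :: "'a \<Rightarrow>\<^sub>L real"
  have L: "(\<lambda>n. blinfun_apply f (x n)) \<longlonglongrightarrow> L f" for f
    unfolding L_def using conv by (simp add: convergent_LIMSEQ_iff)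
  have "bounded_linear L"
  proof (rule bounded_linear_intro[where K = R])
    fix f g :: "'a \<Rightarrow>\<^sub>L real"
    have "(\<lambda>n. blinfun_apply (f + g) (x n)) \<longlonglongrightarrow> L f + L g"
      unfolding blinfun.add_left by (intro tendsto_add L)
    then show "L (f + g) = L f + L g" using L LIMSEQ_unique by blast
  next
    fix t :: real and f :: "'a \<Rightarrow>\<^sub>L real"
    have "(\<lambda>n. blinfun_apply (t *\<^sub>R f) (x n)) \<longlonglongrightarrow> t *\<^sub>R L f"
      unfolding blinfun.scaleR_left by (intro tendsto_scaleR tendsto_const L)
    then show "L (t *\<^sub>R f) = t *\<^sub>R L f" using L LIMSEQ_unique by blast
  next
    fix f :: "'a \<Rightarrow>\<^sub>L real"
    have "norm (blinfun_apply f (x n)) \<le> norm f * R" for n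
      using norm_blinfun[of f "x n"] bound[of n]
      by (meson mult_left_mono norm_ge_zero order_trans)
    then show "norm (L f) \<le> norm f * R"
      by (intro LIMSEQ_le_const2[OF tendsto_norm[OF L[of f]]]) blast
  qed
  moreover obtain l where "Blinfun L = bidual_embed l"
    using reflexive unfolding reflexive_space_def by (metis surjD)
  ultimately have "blinfun_apply f l = L f" for f
    using bidual_embed.rep_eq[of l] bounded_linear_Blinfun_apply[of L] by metis
  then have "weakly_tendsto x l"
    using L by (simp add: weakly_tendsto_iff)
  then show ?thesis by (rule that)
qed

text \<open>
  In a reflexive space every element of the bidual is evaluation at a point, so a sequence of
  functionals that separates points has dense span in the dual. A diagonal argument makes these
  countably many functionals converge along a subsequence, and density does the rest.
\<close>
lemma bounded_weakly_convergent_subsequence: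
  fixes x :: "nat \<Rightarrow> 'a::real_normed_vector"
  assumes reflexive: "reflexive_space TYPE('a)"
    and separable: "separable_space (euclidean :: 'a topology)"
    and bound: "\<And>n. norm (x n) \<le> R"
  obtains r l where "strict_mono r" "weakly_tendsto (x \<circ> r) l"
proof -
  obtain \<phi> :: "nat \<Rightarrow> 'a \<Rightarrow>\<^sub>L real" where \<phi>: "\<And>n. norm (\<phi> n) \<le> 1"
    and sep: "\<And>x. (\<And>n. blinfun_apply (\<phi> n) x = 0) \<Longrightarrow> x = 0"
    using separating_functionals[OF separable] by blast
  have dense: "closure (span (range \<phi>)) = UNIV"
  proof (rule dense_span_if_annihilator_trivial)
    fix G :: "('a \<Rightarrow>\<^sub>L real) \<Rightarrow>\<^sub>L real"
    assume zero: "\<And>s. s \<in> range \<phi> \<Longrightarrow> blinfun_apply G s = 0"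
    obtain z where z: "G = bidual_embed z"
      using reflexive unfolding reflexive_space_def by (metis surjD)
    have "z = 0" using zero by (intro sep) (auto simp: z bidual_embed.rep_eq)
    then show "G = 0" by (intro blinfun_eqI) (simp add: z bidual_embed.rep_eq)
  qed
  have bound\<phi>: "norm (blinfun_apply f (x n)) \<le> R" if "f \<in> range \<phi>" for f n
  proof -
    have "norm (blinfun_apply f (x n)) \<le> norm f * norm (x n)" by (rule norm_blinfun)
    also have "\<dots> \<le> 1 * norm (x n)"
      using that \<phi> by (intro mult_right_mono) auto
    finally show ?thesis using bound[of n] by simp
  qed
  obtain r :: "nat \<Rightarrow> nat" where r: "strict_mono r"
    and lim: "\<And>f. f \<in> range \<phi> \<Longrightarrow> \<exists>l. (\<lambda>n. blinfun_apply f (x (r n))) \<longlonglongrightarrow> l"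
    by (rule function_convergent_subsequence[of "range \<phi>" "\<lambda>n f. blinfun_apply f (x n)" R])
      (use bound\<phi> in auto)
  have "convergent (\<lambda>n. blinfun_apply f ((x \<circ> r) n))" for f :: "'a \<Rightarrow>\<^sub>L real"
  proof (rule convergent_on_closure_span)
    show "norm ((x \<circ> r) n) \<le> R" for n using bound by simp
    show "convergent (\<lambda>n. blinfun_apply g ((x \<circ> r) n))" if "g \<in> range \<phi>" for g
      using lim[OF that] by (simp add: convergent_def)
    show "f \<in> closure (span (range \<phi>))" by (simp add: dense)
  qed
  then obtain l where "weakly_tendsto (x \<circ> r) l"
    using weak_limit_if_functionals_converge[OF reflexive, of "x \<circ> r" R] bound by auto
  with r show ?thesis by (rule that)
qed

section \<open>The penalised functionals and Mosco convergence\<close>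
lemma dist_set_sq_less_iff:
  "(dist_set z A)\<^sup>2 < ereal M \<longleftrightarrow> (\<exists>a\<in>A. (norm (z - a))\<^sup>2 < M)"
proof
  have nonneg: "0 \<le> dist_set z A"
    by (auto simp: dist_set_def intro: INF_greatest)
  {
    assume less: "(dist_set z A)\<^sup>2 < ereal M"
    show "\<exists>a\<in>A. (norm (z - a))\<^sup>2 < M"
    proof (rule ccontr)
      assume "\<not> ?thesis"
      then have "sqrt M \<le> norm (z - a)" if "a \<in> A" for a
        using that by (auto simp: not_less intro: real_le_lsqrt)
      then have "ereal (sqrt M) \<le> dist_set z A"
        unfolding dist_set_def by (intro INF_greatest) simp
      moreover have "0 < M"
      proof -
        have "0 \<le> (dist_set z A)\<^sup>2" using nonneg by (simp add: power2_eq_square)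
        also note less
        finally show ?thesis by simp
      qed
      ultimately have "ereal (sqrt M) * ereal (sqrt M) \<le> dist_set z A * dist_set z A"
        by (intro ereal_mult_mono) (auto simp: nonneg)
      with \<open>0 < M\<close> less show False by (simp add: power2_eq_square)
    qed
  }
  assume "\<exists>a\<in>A. (norm (z - a))\<^sup>2 < M"
  then obtain a where a: "a \<in> A" "(norm (z - a))\<^sup>2 < M" by blast
  have "dist_set z A \<le> ereal (norm (z - a))"
    unfolding dist_set_def using a(1) by (rule INF_lower)
  then have "(dist_set z A)\<^sup>2 \<le> ereal (norm (z - a)) * ereal (norm (z - a))"
    unfolding power2_eq_square using nonneg by (intro ereal_mult_mono) auto
  also have "\<dots> < ereal M" using a(2) by (simp add: power2_eq_square)
  finally show "(dist_set z A)\<^sup>2 < ereal M" .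
qed

lemma penalised_less_iff:
  "ind_fun E z + (dist_set z A)\<^sup>2 < ereal M \<longleftrightarrow> z \<in> E \<and> (\<exists>a\<in>A. (norm (z - a))\<^sup>2 < M)"
  by (simp add: ind_fun_def dist_set_sq_less_iff)

lemma mosco_limit_set_recovery:
  assumes "mosco_limit_set Ds D" "a \<in> D"
  obtains x where "x \<longlonglongrightarrow> a" "\<forall>\<^sub>F h in sequentially. x h \<in> Ds h"
proof -
  obtain x where x: "x \<longlonglongrightarrow> a" "(\<lambda>h. ind_fun (Ds h) (x h)) \<longlonglongrightarrow> ind_fun D a"
    using assms(1) unfolding mosco_limit_set_def mosco_limit_def by blast
  have "\<forall>\<^sub>F h in sequentially. ind_fun (Ds h) (x h) < 1"
    using x(2) by (rule order_tendstoD) (simp add: ind_fun_def assms(2))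
  then have "\<forall>\<^sub>F h in sequentially. x h \<in> Ds h"
    by (rule eventually_mono) (auto simp: ind_fun_def split: if_splits)
  with x(1) that show ?thesis by blast
qed

text \<open>
  Mosco convergence speaks of full sequences. The indices missed by \<open>h\<close> are filled with the weak
  limit \<open>a\<close> itself: this keeps weak convergence, and passing to the subsequence only increases the
  lower limit, which makes the filled-in values harmless.
\<close>
lemma mosco_limit_set_weak_cluster:
  assumes mosco: "mosco_limit_set Ds D" and h: "strict_mono h"
    and w: "\<And>k. w k \<in> Ds (h k)" and weak: "weakly_tendsto w a"
  shows "a \<in> D"
proof -
  have inj: "inj h" using h by (rule strict_mono_imp_inj_on)
  define x where "x n = (if n \<in> range h then w (inv h n) else a)" for n
  have xh: "x (h k) = w k" for k by (simp add: x_def inj)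
  have "weakly_tendsto x a"
    unfolding weakly_tendsto_iff
  proof (intro allI LIMSEQ_I)
    fix f :: "'a \<Rightarrow>\<^sub>L real" and e :: real
    assume e: "0 < e"
    obtain K where K: "\<And>k. k \<ge> K \<Longrightarrow> norm (blinfun_apply f (w k) - blinfun_apply f a) < e"
      using LIMSEQ_D[OF weakly_tendstoD[OF weak, of f] e] by blast
    have "norm (blinfun_apply f (x n) - blinfun_apply f a) < e" if "n \<ge> h K" for n
    proof (cases "n \<in> range h")
      case True
      then obtain k where k: "n = h k" by blast
      with that have "k \<ge> K" using h by (simp add: strict_mono_less_eq)
      then show ?thesis using K by (simp add: k xh)
    next
      case False
      then show ?thesis using e by (simp add: x_def)
    qed
    then show "\<exists>N. \<forall>n\<ge>N. norm (blinfun_apply f (x n) - blinfun_apply f a) < e" by blast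
  qed
  then have "ind_fun D a \<le> liminf (\<lambda>n. ind_fun (Ds n) (x n))"
    using mosco unfolding mosco_limit_set_def mosco_limit_def by blast
  also have "\<dots> \<le> liminf ((\<lambda>n. ind_fun (Ds n) (x n)) \<circ> h)"
    using h by (rule liminf_subseq_mono)
  also have "(\<lambda>n. ind_fun (Ds n) (x n)) \<circ> h = (\<lambda>k. 0)"
    using w by (auto simp: xh ind_fun_def)
  finally show ?thesis by (auto simp: ind_fun_def Liminf_const split: if_splits)
qed

text \<open>
  A nearly closest point of the limit set is a strong limit of points of the approximating sets, and
  these are competitors for the distances.
\<close>
lemma limsup_dist_sq_le:
  assumes mosco: "mosco_limit_set Ds D"
  shows "limsup (\<lambda>h. (dist_set x (Ds h))\<^sup>2) \<le> (dist_set x D)\<^sup>2"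
proof (rule ccontr)
  assume "\<not> ?thesis"
  then obtain M where M: "(dist_set x D)\<^sup>2 < ereal M" "ereal M < limsup (\<lambda>h. (dist_set x (Ds h))\<^sup>2)"
    using ereal_dense2 by (auto simp: not_le)
  then obtain a where a: "a \<in> D" "(norm (x - a))\<^sup>2 < M"
    by (auto simp: dist_set_sq_less_iff)
  obtain y where y: "y \<longlonglongrightarrow> a" "\<forall>\<^sub>F h in sequentially. y h \<in> Ds h"
    using mosco_limit_set_recovery[OF mosco a(1)] by blast
  have "(\<lambda>h. (norm (x - y h))\<^sup>2) \<longlonglongrightarrow> (norm (x - a))\<^sup>2"
    by (intro tendsto_intros y(1))
  then have "\<forall>\<^sub>F h in sequentially. (norm (x - y h))\<^sup>2 < M"
    using a(2) by (rule order_tendstoD)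
  with y(2) have "\<forall>\<^sub>F h in sequentially. (dist_set x (Ds h))\<^sup>2 < ereal M"
    by eventually_elim (auto simp: dist_set_sq_less_iff)
  then have "limsup (\<lambda>h. (dist_set x (Ds h))\<^sup>2) \<le> ereal M"
    by (auto intro!: Limsup_bounded elim!: eventually_mono)
  with M(2) show False by simp
qed

text \<open>
  Countably many functionals yield a decreasing sequence of weak neighbourhoods \<open>U k\<close> of \<open>x\<close>.
  A lower limit below \<open>M\<close> allows arbitrarily large indices with a value below \<open>M\<close> in each of them. The
  points found in this way are not claimed to converge weakly: that is a matter of compactness,
  after which the functionals only have to identify the limit.
\<close>
lemma gamma_liminf_sequence:
  fixes F :: "nat \<Rightarrow> 'a::real_normed_vector \<Rightarrow> ereal" and \<phi> :: "nat \<Rightarrow> 'a \<Rightarrow>\<^sub>L real"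
  assumes less: "\<And>U. openin weak_topology U \<Longrightarrow> x \<in> U \<Longrightarrow> liminf (\<lambda>h. INF y\<in>U. F h y) < M"
  shows "\<exists>(h :: nat \<Rightarrow> nat) y. strict_mono h \<and> (\<forall>k. F (h k) (y k) < M) \<and>
    (\<forall>i. (\<lambda>k. blinfun_apply (\<phi> i) (y k)) \<longlonglongrightarrow> blinfun_apply (\<phi> i) x)"
proof -
  define U where "U k = (\<Inter>i\<in>{..k}. blinfun_apply (\<phi> i) -`
    ball (blinfun_apply (\<phi> i) x) (1 / Suc k))" for k
  have "openin weak_topology (U k)" for k
    unfolding U_def
  proof (intro openin_INT2)
    fix i
    show "openin weak_topology (blinfun_apply (\<phi> i) -` ball (blinfun_apply (\<phi> i) x) (1 / Suc k))"
      unfolding weak_topology_def by (rule topology_generated_by_Basis) blast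
  qed auto
  moreover have "x \<in> U k" for k by (auto simp: U_def)
  ultimately have U: "liminf (\<lambda>h. INF y\<in>U k. F h y) < M" for k
    using less by blast
  have ex: "\<exists>h y. h > n \<and> y \<in> U k \<and> F h y < M" for k and n :: nat
  proof (rule ccontr)
    assume "\<not> ?thesis"
    then have "\<forall>\<^sub>F h in sequentially. M \<le> (INF y\<in>U k. F h y)"
      by (intro eventually_mono[OF eventually_gt_at_top[of n]] INF_greatest) (meson not_le)
    then have "M \<le> liminf (\<lambda>h. INF y\<in>U k. F h y)" by (rule Liminf_bounded)
    with U[of k] show False by simp
  qed
  have "\<exists>s. \<forall>k. (snd (s k) \<in> U k \<and> F (fst (s k)) (snd (s k)) < M) \<and> fst (s k) < fst (s (Suc k))"
  proof (rule dependent_nat_choice)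
    show "\<exists>s. snd s \<in> U 0 \<and> F (fst s) (snd s) < M"
      using ex[of _ 0] by fastforce
  next
    fix s k
    obtain h y where "h > fst s" "y \<in> U (Suc k)" "F h y < M" using ex by blast
    then show "\<exists>t. (snd t \<in> U (Suc k) \<and> F (fst t) (snd t) < M) \<and> fst s < fst t"
      by (intro exI[of _ "(h, y)"]) simp
  qed
  then obtain s where s: "\<And>k. snd (s k) \<in> U k" "\<And>k. F (fst (s k)) (snd (s k)) < M"
    "\<And>k. fst (s k) < fst (s (Suc k))"
    by blast
  have "(\<lambda>k. blinfun_apply (\<phi> i) (snd (s k))) \<longlonglongrightarrow> blinfun_apply (\<phi> i) x" for i
  proof (rule tendsto_dist_iff[THEN iffD2], rule tendsto_sandwich[where f = "\<lambda>_. 0"])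
    show "\<forall>\<^sub>F k in sequentially. dist (blinfun_apply (\<phi> i) (snd (s k))) (blinfun_apply (\<phi> i) x) \<le> 1 / Suc k"
      using eventually_ge_at_top[of i]
    proof eventually_elim
      case (elim k)
      then show ?case using s(1)[of k] by (auto simp: U_def dist_commute intro: less_imp_le)
    qed
    show "(\<lambda>k. 1 / real (Suc k)) \<longlonglongrightarrow> 0"
      using LIMSEQ_inverse_real_of_nat by (simp add: inverse_eq_divide)
  qed auto
  moreover have "strict_mono (\<lambda>k. fst (s k))"
    using s(3) by (simp add: strict_mono_Suc_iff)
  ultimately show ?thesis
    using s(2) by (intro exI[of _ "\<lambda>k. fst (s k)"] exI[of _ "\<lambda>k. snd (s k)"]) simp
qed

text \<open>
  This is coercivity: transversality turns a bound on the distance of \<open>z\<close> and \<open>a\<close> into a bound on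
  each of them, with a constant that depends on \<open>M\<close>, \<open>b\<close> and \<open>c\<close> only.
\<close>
lemma transversal_bound:
  fixes c b :: real
  assumes c: "c > 0" and trans: "norm (a - z) \<ge> c * (norm a + norm z) - b"
    and small: "(norm (z - a))\<^sup>2 < M"
  shows "norm z \<le> (sqrt M + b) / c" "norm a \<le> (sqrt M + b) / c"
proof -
  have "norm (a - z) \<le> sqrt M"
    using small by (simp add: norm_minus_commute real_le_rsqrt)
  with trans have sum: "c * (norm a + norm z) \<le> sqrt M + b" by simp
  have "c * norm z \<le> c * (norm a + norm z)" "c * norm a \<le> c * (norm a + norm z)"
    using c by auto
  with sum have "c * norm z \<le> sqrt M + b" "c * norm a \<le> sqrt M + b" by linarith+
  then show "norm z \<le> (sqrt M + b) / c" "norm a \<le> (sqrt M + b) / c"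
    using c by (simp_all add: field_simps)
qed

section \<open>Gamma-convergence and equicoercivity\<close>
theorem theorem2p8:
  fixes D :: "'z::banach set" and Dh :: "nat \<Rightarrow> 'z set" and E :: "'z set"
    and c b :: real
  assumes reflexive: "reflexive_space TYPE('z)"
    and separable: "separable_space (euclidean :: 'z topology)"
    and closed: "weakly_seq_closed E"
    and mosco: "mosco_limit_set Dh D"
    and c_pos: "c > 0" and b_nonneg: "b \<ge> 0"
    and transversal: "\<And>h y z. y \<in> Dh h \<Longrightarrow> z \<in> E \<Longrightarrow>
      norm (y - z) \<ge> c * (norm y + norm z) - b"
  shows "gamma_limit weak_topology
           (\<lambda>h z. ind_fun E z + (dist_set z (Dh h))\<^sup>2)
           (\<lambda>z. ind_fun E z + (dist_set z D)\<^sup>2) \<and>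
         (\<forall>zh :: nat \<Rightarrow> 'z.
           (SUP h. ind_fun E (zh h) + (dist_set (zh h) (Dh h))\<^sup>2) < \<infinity> \<longrightarrow>
           (\<exists>r z. strict_mono r \<and> z \<in> E \<and> weakly_tendsto (zh \<circ> r) z))"
proof -
  define F where "F h z = ind_fun E z + (dist_set z (Dh h))\<^sup>2" for h z
  define G where "G z = ind_fun E z + (dist_set z D)\<^sup>2" for z
  \<comment> \<open>Two extractions in a row, so that almost closest points \<open>w\<close> converge along with the points \<open>y\<close>.\<close>
  have compact: "\<exists>r w z a. strict_mono r \<and> weakly_tendsto (y \<circ> r) z \<and> z \<in> E \<and>
      (\<forall>k. w k \<in> Dh (h (r k)) \<and> (norm (y (r k) - w k))\<^sup>2 < M) \<and> weakly_tendsto w a"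
    if small: "\<And>k. F (h k) (y k) < ereal M" for h :: "nat \<Rightarrow> nat" and y M
  proof -
    have yE: "y k \<in> E" for k
      using small[of k] by (simp add: F_def penalised_less_iff)
    have "\<forall>k. \<exists>v. v \<in> Dh (h k) \<and> (norm (y k - v))\<^sup>2 < M"
      using small by (auto simp: F_def penalised_less_iff)
    then obtain v where v: "\<And>k. v k \<in> Dh (h k)" "\<And>k. (norm (y k - v k))\<^sup>2 < M"
      by metis
    note bound = transversal_bound[OF c_pos transversal[OF v(1) yE] v(2)]
    have "norm (y k) \<le> (sqrt M + b) / c" for k
      using bound(1) .
    then obtain r z where r: "strict_mono r" "weakly_tendsto (y \<circ> r) z"
      by (rule bounded_weakly_convergent_subsequence[OF reflexive separable])
    have "norm ((v \<circ> r) k) \<le> (sqrt M + b) / c" for k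
      using bound(2) by simp
    then obtain s a where s: "strict_mono s" "weakly_tendsto ((v \<circ> r) \<circ> s) a"
      by (rule bounded_weakly_convergent_subsequence[OF reflexive separable])
    have "z \<in> E"
      using closed r(2) yE unfolding weakly_seq_closed_def by (metis comp_apply)
    moreover have "weakly_tendsto (y \<circ> (r \<circ> s)) z"
      using limitin_subsequence[OF s(1) r(2)] by (simp add: comp_assoc)
    moreover have "strict_mono (r \<circ> s)"
      using r(1) s(1) by (rule strict_mono_o)
    ultimately show ?thesis
      using s(2) v by (intro exI[of _ "r \<circ> s"] exI[of _ "v \<circ> r \<circ> s"] exI[of _ z] exI[of _ a]) auto
  qed

  have lower: "G x \<le> (SUP U\<in>{U. openin weak_topology U \<and> x \<in> U}. liminf (\<lambda>h. INF y\<in>U. F h y))"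
    (is "_ \<le> ?S") for x
  proof (rule ccontr)
    assume "\<not> ?thesis"
    then obtain M where M: "?S < ereal M" "ereal M < G x"
      using ereal_dense2 by (auto simp: not_le)
    obtain \<phi> :: "nat \<Rightarrow> 'z \<Rightarrow>\<^sub>L real"
      where sep: "\<And>x. (\<And>n. blinfun_apply (\<phi> n) x = 0) \<Longrightarrow> x = 0"
      using separating_functionals[OF separable] by blast
    have "liminf (\<lambda>h. INF y\<in>U. F h y) < ereal M" if "openin weak_topology U" "x \<in> U" for U
      using that by (intro le_less_trans[OF SUP_upper M(1)]) auto
    then have "\<exists>(h :: nat \<Rightarrow> nat) y. strict_mono h \<and> (\<forall>k. F (h k) (y k) < ereal M) \<and>
        (\<forall>i. (\<lambda>k. blinfun_apply (\<phi> i) (y k)) \<longlonglongrightarrow> blinfun_apply (\<phi> i) x)"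
      by (rule gamma_liminf_sequence)
    then obtain h y where h: "strict_mono (h :: nat \<Rightarrow> nat)" and y: "\<And>k. F (h k) (y k) < ereal M"
      and lim: "\<And>i. (\<lambda>k. blinfun_apply (\<phi> i) (y k)) \<longlonglongrightarrow> blinfun_apply (\<phi> i) x"
      by auto
    obtain r w z a where r: "strict_mono r" "weakly_tendsto (y \<circ> r) z" "z \<in> E"
      and w: "\<And>k. w k \<in> Dh (h (r k))" "\<And>k. (norm (y (r k) - w k))\<^sup>2 < M" "weakly_tendsto w a"
      using compact[of h y M] y by blast
    \<comment> \<open>The separating functionals cannot tell \<open>z\<close> from \<open>x\<close>, so the cluster point is the given one.\<close>
    have "z - x = 0"
    proof (rule sep)
      fix i
      have "(\<lambda>k. blinfun_apply (\<phi> i) ((y \<circ> r) k)) \<longlonglongrightarrow> blinfun_apply (\<phi> i) x"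
        using LIMSEQ_subseq_LIMSEQ[OF lim r(1)] by (simp add: comp_def)
      then have "blinfun_apply (\<phi> i) z = blinfun_apply (\<phi> i) x"
        by (rule LIMSEQ_unique[OF weakly_tendstoD[OF r(2)]])
      then show "blinfun_apply (\<phi> i) (z - x) = 0" by (simp add: blinfun.diff_right)
    qed
    then have zx: "z = x" by simp
    have "a \<in> D"
      using mosco_limit_set_weak_cluster[OF mosco strict_mono_o[OF h r(1)], of w a] w by simp
    have "weakly_tendsto (\<lambda>k. y (r k) - w k) (x - a)"
      using weakly_tendstoD[OF r(2)] weakly_tendstoD[OF w(3)]
      by (auto simp: weakly_tendsto_iff blinfun.diff_right zx intro!: tendsto_diff)
    moreover have "norm (y (r k) - w k) \<le> sqrt M" for k
      using w(2)[of k] by (simp add: real_le_rsqrt)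
    ultimately have xa: "norm (x - a) \<le> sqrt M"
      by (rule norm_le_weak_limit)
    have "0 \<le> M" using w(2)[of 0] zero_le_power2 by (meson less_imp_le order_trans)
    then have sq: "(norm (x - a))\<^sup>2 \<le> M"
      using power_mono[OF xa, of 2] by simp
    \<comment> \<open>Weak limits preserve only \<open>\<le>\<close>, while values of \<open>G\<close> are accessible through strict bounds; hence the slack \<open>N\<close>.\<close>
    obtain N where N: "ereal M < ereal N" "ereal N < G x"
      using ereal_dense2[OF M(2)] by blast
    from sq N(1) have "(norm (x - a))\<^sup>2 < N" by simp
    with \<open>a \<in> D\<close> r(3) have "G x < ereal N"
      by (auto simp: G_def penalised_less_iff zx)
    with N(2) show False by simp
  qed

  have upper: "(SUP U\<in>{U. openin weak_topology U \<and> x \<in> U}. limsup (\<lambda>h. INF y\<in>U. F h y)) \<le> G x" for x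
  proof (rule SUP_least)
    fix U assume U: "U \<in> {U. openin weak_topology U \<and> x \<in> U}"
    \<comment> \<open>The constant sequence \<open>x\<close> is a recovery sequence.\<close>
    have "limsup (\<lambda>h. INF y\<in>U. F h y) \<le> limsup (\<lambda>h. F h x)"
      using U by (intro Limsup_mono always_eventually) (auto intro: INF_lower)
    also have "\<dots> \<le> G x"
      using limsup_dist_sq_le[OF mosco, of x]
      by (cases "x \<in> E") (auto simp: F_def G_def ind_fun_def)
    finally show "limsup (\<lambda>h. INF y\<in>U. F h y) \<le> G x" .
  qed

  have mid: "(SUP U\<in>{U. openin weak_topology U \<and> x \<in> U}. liminf (\<lambda>h. INF y\<in>U. F h y)) \<le>
      (SUP U\<in>{U. openin weak_topology U \<and> x \<in> U}. limsup (\<lambda>h. INF y\<in>U. F h y))" for x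
    by (intro SUP_mono' Liminf_le_Limsup) simp

  have gamma: "gamma_limit weak_topology F G"
    unfolding gamma_limit_def
    using order_trans[OF lower mid] order_trans[OF mid upper] lower upper
    by (intro ballI conjI antisym) simp_all

  have "\<exists>r z. strict_mono r \<and> z \<in> E \<and> weakly_tendsto (zh \<circ> r) z"
    if finite: "(SUP h. F h (zh h)) < \<infinity>" for zh
  proof -
    obtain M :: real where M: "(SUP h. F h (zh h)) < ereal M"
      using ereal_dense2[OF finite] by blast
    have "F h (zh h) < ereal M" for h
      by (rule le_less_trans[OF SUP_upper M]) simp
    then show ?thesis
      using compact[of "\<lambda>h. h" zh M] by blast
  qed
  with gamma show ?thesis unfolding F_def G_def by blast
qed

end
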